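(* Let $P$ be a Fano polytope (of any dimension, not necessarily smooth). If $P$ is symmetric, then $P$ is Kähler–Einstein.
   Context: Let $N\cong\mathbb{Z}^n$ be a lattice, $M=\mathrm{Hom}(N,\mathbb{Z})$ its dual lattice, $N_{\mathbb{R}}=N\otimes_{\mathbb{Z}}\mathbb{R}$, $M_{\mathbb{R}}=M\otimes_{\mathbb{Z}}\mathbb{R}$. A Fano polytope $P\subset N_{\mathbb{R}}$ is a full-dimensional convex lattice polytope whose vertices are primitive lattice points of $N$ and which contains the origin in its interior. The automorphism group $Aut(P)$ is the group of all elements of $GL_{\mathbb{Z}}(N)$ preserving $P$. $P$ is symmetric if the origin is the only point fixed by all elements of $Aut(P)$. The dual (moment) polytope of $P$ is $P^*=\{w\in M_{\mathbb{R}} : \langle w,v\rangle\geq -1 \text{ for every } v\in P\}$. $P$ is Kähler–Einstein if the barycenter of $P^*$ is the origin. *)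

theory Defs
  imports "HOL-Analysis.Analysis"
begin

text \<open>
  A \<open>\<int>\<close>-basis of \<open>N\<close> identifies \<open>N\<close> with the integer points of \<open>N\<^sub>\<real>\<close> = \<open>real ^ 'n\<close>, and the dual
  basis identifies \<open>M\<^sub>\<real>\<close> with \<open>real ^ 'n\<close> as well; the pairing of \<open>M\<^sub>\<real>\<close> with \<open>N\<^sub>\<real>\<close> is then the
  inner product.
\<close>

definition lattice_points :: "(real ^ 'n) set" where
  "lattice_points = {x. \<forall>i. x $ i \<in> \<int>}"

definition primitive_point :: "real ^ 'n \<Rightarrow> bool" where
  "primitive_point v \<longleftrightarrow> v \<in> lattice_points \<and> v \<noteq> 0 \<and>
     (\<forall>w \<in> lattice_points. \<forall>k::int. v = of_int k *\<^sub>R w \<longrightarrow> \<bar>k\<bar> = 1)"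

text \<open>
  The extreme points of a polytope are its vertices; a primitive point is in particular a lattice
  point, so a Fano polytope is a lattice polytope.
\<close>

definition fano_polytope :: "(real ^ 'n) set \<Rightarrow> bool" where
  "fano_polytope P \<longleftrightarrow> polytope P \<and> aff_dim P = int CARD('n) \<and>
     (\<forall>v. v extreme_point_of P \<longrightarrow> primitive_point v) \<and> 0 \<in> interior P"

text \<open>
  Elements of \<open>GL\<^sub>\<int>(N)\<close> are represented by their unique \<open>\<real>\<close>-linear extensions to \<open>N\<^sub>\<real>\<close>.
\<close>

definition GL_lattice :: "(real ^ 'n \<Rightarrow> real ^ 'n) set" where
  "GL_lattice = {f. linear f \<and> bij_betw f lattice_points lattice_points}"

definition Aut_polytope :: "(real ^ 'n) set \<Rightarrow> (real ^ 'n \<Rightarrow> real ^ 'n) set" where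
  "Aut_polytope P = {f \<in> GL_lattice. f ` P = P}"

definition symmetric_polytope :: "(real ^ 'n) set \<Rightarrow> bool" where
  "symmetric_polytope P \<longleftrightarrow> {x. \<forall>f \<in> Aut_polytope P. f x = x} = {0}"

definition dual_polytope :: "(real ^ 'n) set \<Rightarrow> (real ^ 'n) set" where
  "dual_polytope P = {w. \<forall>v \<in> P. w \<bullet> v \<ge> - 1}"

text \<open>
  Meaningful for compact sets of positive volume. The dual of a Fano polytope is such a set: it is
  bounded because \<open>0\<close> is interior to \<open>P\<close>, and \<open>0\<close> is interior to it because \<open>P\<close> is bounded.
\<close>

definition barycenter :: "(real ^ 'n) set \<Rightarrow> real ^ 'n" where
  "barycenter K = (LINT x:K|lebesgue. x) /\<^sub>R measure lebesgue K"

definition kahler_einstein :: "(real ^ 'n) set \<Rightarrow> bool" where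
  "kahler_einstein P \<longleftrightarrow> barycenter (dual_polytope P) = 0"

end

theory Submission
  imports Defs
begin

text \<open>
  An automorphism \<open>f\<close> of \<open>P\<close> acts on the dual side by its adjoint, which preserves
  \<open>dual_polytope P\<close>. An invertible linear map carries the barycenter of a set to the barycenter of its image,
  so the barycenter \<open>b\<close> of the dual polytope is fixed by all these adjoints; in other words, the
  functional \<open>x \<mapsto> b \<bullet> x\<close> is invariant under the automorphism group of \<open>P\<close>.

  Symmetry says that the group has no nonzero fixed vector in the space of \<open>P\<close>, whereas \<open>b\<close> is a
  fixed vector in the dual space. The passage from one to the other
  (\<open>symmetric_invariant_functional_zero\<close>) uses the vertices of \<open>P\<close>: the automorphisms permute the
  finitely many vertices at which \<open>b\<close> is positive, so the sum of these vertices is a fixed vector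
  and hence \<open>0\<close>. But \<open>b\<close> is positive on a nonempty sum of such vertices, so there are none. Thus
  \<open>b \<le> 0\<close> on all of \<open>P\<close>, and since \<open>P\<close> is a neighbourhood of the origin, \<open>b = 0\<close>.

  That the barycenter is equivariant (\<open>barycenter_fixed_by_linear\<close>) rests on the fact that a
  surjective linear map \<open>T\<close> with \<open>T -` K = K\<close> for a single set \<open>K\<close> of finite positive volume
  preserves Lebesgue measure altogether. This is proved without determinants, by the argument that
  shows the uniqueness of Haar measure (\<open>lborel_distr_linear_preserving\<close>).
\<close>

section \<open>Linear maps preserving a set preserve volume\<close>

lemma nn_integral_lborel_translate:
  fixes g :: "'a::euclidean_space \<Rightarrow> ennreal"
  assumes [measurable]: "g \<in> borel_measurable borel"
  shows "(\<integral>\<^sup>+y. g (c + y) \<partial>lborel) = (\<integral>\<^sup>+y. g y \<partial>lborel)"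
proof -
  have "(\<integral>\<^sup>+y. g y \<partial>lborel) = (\<integral>\<^sup>+y. g y \<partial>distr lborel borel ((+) c))"
    by (simp add: lborel_distr_plus)
  also have "\<dots> = (\<integral>\<^sup>+y. g (c + y) \<partial>lborel)"
    by (subst nn_integral_distr) auto
  finally show ?thesis by simp
qed

lemma nn_integral_lborel_reflect:
  fixes g :: "'a::euclidean_space \<Rightarrow> ennreal"
  assumes [measurable]: "g \<in> borel_measurable borel"
  shows "(\<integral>\<^sup>+y. g (c - y) \<partial>lborel) = (\<integral>\<^sup>+y. g y \<partial>lborel)"
proof -
  have "(lborel :: 'a measure) = distr lborel borel (\<lambda>y. c + (-1) *\<^sub>R y)"
    using lborel_affine[of "-1" c] by (simp add: density_1)
  then have "(\<integral>\<^sup>+y. g y \<partial>lborel) = (\<integral>\<^sup>+y. g y \<partial>distr lborel borel (\<lambda>y. c + (-1) *\<^sub>R y))"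
    by (rule arg_cong[where f = "\<lambda>M. nn_integral M g"])
  also have "\<dots> = (\<integral>\<^sup>+y. g (c - y) \<partial>lborel)"
    by (subst nn_integral_distr) auto
  finally show ?thesis by simp
qed

text \<open>
  The image \<open>\<nu>\<close> of Lebesgue measure \<open>\<mu>\<close> under \<open>T\<close> is translation invariant, because \<open>T\<close> is linear
  and onto. As in the proof that such a measure is unique up to a factor, one evaluates the double
  integral of \<open>\<one>\<^sub>K(x) \<one>\<^sub>B(x + T y)\<close> in both orders. Integrating over \<open>y\<close> first gives \<open>\<mu>(K) \<nu>(B)\<close>.
  If instead \<open>x\<close> is first shifted by \<open>T y\<close>, the integrand becomes \<open>\<one>\<^sub>K(x - T y) \<one>\<^sub>B(x)\<close>; its integral
  over \<open>y\<close> is \<open>\<mu>(K) \<one>\<^sub>B(x)\<close>, because \<open>T -` K = K\<close> and \<open>\<mu>\<close> is invariant under reflections, and the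
  total is \<open>\<mu>(K) \<mu>(B)\<close>. Cancelling \<open>\<mu>(K)\<close> gives \<open>\<nu> = \<mu>\<close>.
\<close>
lemma lborel_distr_linear_preserving:
  fixes T :: "'a::euclidean_space \<Rightarrow> 'a"
  assumes lin: "linear T" and sur: "surj T"
    and K [measurable]: "K \<in> sets borel" and TK: "T -` K = K"
    and pos: "emeasure lborel K \<noteq> 0" and fin: "emeasure lborel K \<noteq> \<infinity>"
  shows "distr lborel borel T = lborel"
proof (rule measure_eqI)
  show "sets (distr lborel borel T) = sets lborel" by simp
next
  have T [measurable]: "T \<in> borel_measurable borel"
    using lin by (simp add: borel_measurable_continuous_onI linear_continuous_on linear_conv_bounded_linear)
  fix B assume "B \<in> sets (distr lborel borel T)"
  then have B [measurable]: "B \<in> sets borel" by simp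
  let ?K = "indicator K :: 'a \<Rightarrow> ennreal" and ?B = "indicator B :: 'a \<Rightarrow> ennreal"
  have nu: "emeasure (distr lborel borel T) B = (\<integral>\<^sup>+y. ?B (T y) \<partial>lborel)"
    by (simp add: nn_integral_distr flip: nn_integral_indicator)
  have inner1: "(\<integral>\<^sup>+y. ?B (x + T y) \<partial>lborel) = emeasure (distr lborel borel T) B" for x
  proof -
    obtain x' where x': "x = T x'" using sur by blast
    have "(\<integral>\<^sup>+y. ?B (x + T y) \<partial>lborel) = (\<integral>\<^sup>+y. ?B (T (x' + y)) \<partial>lborel)"
      by (simp add: x' linear_add[OF lin])
    also have "\<dots> = (\<integral>\<^sup>+y. ?B (T y) \<partial>lborel)"
      by (rule nn_integral_lborel_translate) measurable
    finally show ?thesis by (simp add: nu)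
  qed
  have inner2: "(\<integral>\<^sup>+y. ?K (x - T y) \<partial>lborel) = emeasure lborel K" for x
  proof -
    obtain x' where x': "x = T x'" using sur by blast
    have "?K (x - T y) = ?K (x' - y)" for y
      using TK by (auto simp: x' indicator_def simp flip: linear_diff[OF lin])
    then have "(\<integral>\<^sup>+y. ?K (x - T y) \<partial>lborel) = (\<integral>\<^sup>+y. ?K (x' - y) \<partial>lborel)"
      by simp
    also have "\<dots> = (\<integral>\<^sup>+y. ?K y \<partial>lborel)"
      by (rule nn_integral_lborel_reflect) measurable
    finally show ?thesis by simp
  qed
  have "emeasure lborel K * emeasure (distr lborel borel T) B
      = (\<integral>\<^sup>+x. ?K x * (\<integral>\<^sup>+y. ?B (x + T y) \<partial>lborel) \<partial>lborel)"
    by (simp add: inner1 nn_integral_multc)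
  also have "\<dots> = (\<integral>\<^sup>+x. (\<integral>\<^sup>+y. ?K x * ?B (x + T y) \<partial>lborel) \<partial>lborel)"
    by (subst nn_integral_cmult) auto
  also have "\<dots> = (\<integral>\<^sup>+y. (\<integral>\<^sup>+x. ?K x * ?B (x + T y) \<partial>lborel) \<partial>lborel)"
    by (rule lborel_pair.Fubini'[symmetric]) measurable
  also have "\<dots> = (\<integral>\<^sup>+y. (\<integral>\<^sup>+x. ?K (x - T y) * ?B x \<partial>lborel) \<partial>lborel)"
  proof (rule nn_integral_cong)
    fix y
    have "(\<integral>\<^sup>+x. ?K (x - T y) * ?B x \<partial>lborel)
        = (\<integral>\<^sup>+x. ?K (T y + x - T y) * ?B (T y + x) \<partial>lborel)"
      by (rule nn_integral_lborel_translate[symmetric]) measurable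
    then show "(\<integral>\<^sup>+x. ?K x * ?B (x + T y) \<partial>lborel) = (\<integral>\<^sup>+x. ?K (x - T y) * ?B x \<partial>lborel)"
      by (simp add: add.commute)
  qed
  also have "\<dots> = (\<integral>\<^sup>+x. (\<integral>\<^sup>+y. ?K (x - T y) * ?B x \<partial>lborel) \<partial>lborel)"
    by (rule lborel_pair.Fubini') measurable
  also have "\<dots> = (\<integral>\<^sup>+x. emeasure lborel K * ?B x \<partial>lborel)"
    by (subst nn_integral_multc) (auto simp: inner2)
  also have "\<dots> = emeasure lborel K * emeasure lborel B"
    by (simp add: nn_integral_cmult)
  finally show "emeasure (distr lborel borel T) B = emeasure lborel B"
    using pos fin by (simp add: ennreal_mult_cancel_left)
qed

lemma barycenter_fixed_by_linear:
  fixes K :: "(real ^ 'n) set"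
  assumes "linear T" "surj T" "T -` K = K" "compact K" "interior K \<noteq> {}"
  shows "T (barycenter K) = barycenter K"
proof -
  have K [measurable]: "K \<in> sets borel"
    using assms by (simp add: borel_compact)
  have T: "bounded_linear T"
    using assms by (simp add: linear_conv_bounded_linear)
  then have Tm [measurable]: "T \<in> borel_measurable borel"
    by (simp add: borel_measurable_continuous_onI linear_continuous_on)
  have "emeasure lborel (interior K) \<noteq> 0"
    using open_not_negligible[of "interior K"] assms(5)
    by (auto simp: negligible_iff_null_sets null_sets_completion_iff null_sets_def)
  then have pos: "emeasure lborel K \<noteq> 0"
    using emeasure_mono[OF interior_subset[of K], of lborel] by auto
  have fin: "emeasure lborel K \<noteq> \<infinity>"
    using emeasure_bounded_finite[OF compact_imp_bounded[OF assms(4)]] by simp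
  let ?g = "\<lambda>x. indicator K x *\<^sub>R x"
  have int: "integrable lborel ?g"
    by (rule borel_integrable_compact) (use assms in auto)
  have "(\<integral>x. ?g x \<partial>lborel) = (\<integral>x. ?g x \<partial>distr lborel borel T)"
    using lborel_distr_linear_preserving[OF assms(1,2) K assms(3) pos fin] by simp
  also have "\<dots> = (\<integral>x. ?g (T x) \<partial>lborel)"
    by (rule integral_distr) auto
  also have "\<dots> = (\<integral>x. T (?g x) \<partial>lborel)"
  proof (rule Bochner_Integration.integral_cong)
    fix x
    have "T x \<in> K \<longleftrightarrow> x \<in> K" using assms(3) by auto
    then show "?g (T x) = T (?g x)"
      using assms(1) by (simp add: indicator_def linear_0)
  qed simp
  also have "\<dots> = T (\<integral>x. ?g x \<partial>lborel)"
    by (rule integral_bounded_linear[OF T int])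
  finally have "T (\<integral>x. ?g x \<partial>lborel) = (\<integral>x. ?g x \<partial>lborel)" ..
  moreover have "(LINT x:K|lebesgue. x) = (\<integral>x. ?g x \<partial>lborel)"
    unfolding set_lebesgue_integral_def by (rule integral_completion) measurable
  ultimately show ?thesis
    by (simp add: barycenter_def linear_scale[OF assms(1)])
qed

section \<open>The dual polytope\<close>

text \<open>
  A point \<open>w\<close> of the dual is tested on the vector of length \<open>e\<close> opposite to \<open>w\<close>, where the pairing
  is \<open>- e * norm w\<close>; this bounds \<open>norm w\<close>.
\<close>
lemma compact_dual_polytope:
  fixes P :: "(real ^ 'n) set"
  assumes "0 \<in> interior P"
  shows "compact (dual_polytope P)"
proof -
  obtain e where e: "e > 0" "cball 0 e \<subseteq> P"
    using assms by (meson mem_interior_cball)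
  have "norm w \<le> 1 / e" if w: "w \<in> dual_polytope P" for w
  proof (cases "w = 0")
    case False
    define v where "v = - (e / norm w) *\<^sub>R w"
    have "v \<in> P" using e False by (auto simp: v_def)
    then have "- 1 \<le> w \<bullet> v" using w by (simp add: dual_polytope_def)
    moreover have "w \<bullet> v = - e * norm w"
      using False by (simp add: v_def dot_square_norm power2_eq_square)
    ultimately show ?thesis using e by (simp add: field_simps)
  qed (use e in auto)
  then have "bounded (dual_polytope P)" by (auto simp: bounded_iff)
  moreover have "dual_polytope P = (\<Inter>v\<in>P. {w. v \<bullet> w \<ge> - 1})"
    by (auto simp: dual_polytope_def inner_commute)
  then have "closed (dual_polytope P)" by (auto intro!: closed_INT simp: closed_halfspace_ge)
  ultimately show ?thesis by (simp add: compact_eq_bounded_closed)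
qed

lemma zero_in_interior_dual_polytope:
  fixes P :: "(real ^ 'n) set"
  assumes "bounded P"
  shows "0 \<in> interior (dual_polytope P)"
proof -
  obtain B where B: "B > 0" "\<And>v. v \<in> P \<Longrightarrow> norm v \<le> B"
    using assms by (auto simp: bounded_pos)
  have "w \<in> dual_polytope P" if w: "norm w \<le> 1 / B" for w
  proof -
    have "- 1 \<le> w \<bullet> v" if "v \<in> P" for v
    proof -
      have "\<bar>w \<bullet> v\<bar> \<le> norm w * norm v" by (rule Cauchy_Schwarz_ineq2)
      also have "\<dots> \<le> (1 / B) * B" by (rule mult_mono) (use w B that in auto)
      finally show ?thesis using B by auto
    qed
    then show ?thesis by (simp add: dual_polytope_def)
  qed
  then have "cball 0 (1 / B) \<subseteq> dual_polytope P" by auto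
  then show ?thesis using B by (auto simp: mem_interior_cball intro!: exI[of _ "1 / B"])
qed

lemma vimage_adjoint_dual_polytope:
  fixes f :: "real ^ 'n \<Rightarrow> real ^ 'n"
  assumes "linear f"
  shows "adjoint f -` dual_polytope P = dual_polytope (f ` P)"
  using adjoint_works[OF assms] by (auto simp: dual_polytope_def inner_commute)

text \<open>
  A set with interior points spans the space, and the span of \<open>P\<close> is mapped onto itself.
\<close>
lemma surj_if_preserves_neighbourhood:
  fixes f :: "'a::euclidean_space \<Rightarrow> 'a"
  assumes "linear f" "f ` P = P" "interior P \<noteq> {}"
  shows "surj f"
proof -
  have "span P = UNIV"
    using affine_hull_nonempty_interior[OF assms(3)] affine_hull_subset_span[of P] by auto
  moreover have "f ` span P = span P"
    using assms by (metis span_linear_image)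
  ultimately show ?thesis by simp
qed

lemma adjoint_fixes_barycenter_dual:
  fixes P :: "(real ^ 'n) set"
  assumes "linear f" "f ` P = P" "bounded P" "0 \<in> interior P"
  shows "adjoint f (barycenter (dual_polytope P)) = barycenter (dual_polytope P)"
proof (rule barycenter_fixed_by_linear)
  have "surj f" using assms by (intro surj_if_preserves_neighbourhood) auto
  then show "surj (adjoint f)"
    using assms(1) by (simp add: linear_surjective_imp_injective)
qed (use assms in \<open>auto simp: adjoint_linear vimage_adjoint_dual_polytope
      compact_dual_polytope dest: zero_in_interior_dual_polytope\<close>)

section \<open>Functionals invariant under the automorphism group\<close>

lemma extreme_point_of_linear_image:
  assumes "linear f" "inj f"
  shows "f v extreme_point_of (f ` P) \<longleftrightarrow> v extreme_point_of P"
  using face_of_linear_image[OF assms, of "{v}" P] by (simp flip: face_of_singleton)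

text \<open>
  Symmetry speaks of fixed vectors, and \<open>b\<close> is a fixed functional. A fixed vector on which \<open>b\<close> is
  positive, unless \<open>b = 0\<close>, is the sum of the vertices of \<open>P\<close> at which \<open>b\<close> is positive.
\<close>
lemma symmetric_invariant_functional_zero:
  fixes P :: "(real ^ 'n) set"
  assumes "polytope P" "0 \<in> interior P" "symmetric_polytope P"
    and inv: "\<And>f x. f \<in> Aut_polytope P \<Longrightarrow> b \<bullet> f x = b \<bullet> x"
  shows "b = 0"
proof -
  define S where "S = {v. v extreme_point_of P \<and> b \<bullet> v > 0}"
  have finS: "finite S"
    using finite_polyhedron_extreme_points[OF polytope_imp_polyhedron[OF assms(1)]]
    by (rule rev_finite_subset) (auto simp: S_def)
  have "f (\<Sum>S) = \<Sum>S" if f: "f \<in> Aut_polytope P" for f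
  proof -
    have lin: "linear f" and fP: "f ` P = P"
      using f by (auto simp: Aut_polytope_def GL_lattice_def)
    have "surj f" using lin fP assms(2) by (intro surj_if_preserves_neighbourhood) auto
    then have inj: "inj f" using lin by (simp add: linear_surjective_imp_injective)
    have "f ` S \<subseteq> S"
      using inv[OF f] extreme_point_of_linear_image[OF lin inj, of _ P] fP by (auto simp: S_def)
    then have "f ` S = S"
      using finS inj by (meson endo_inj_surj inj_on_subset subset_UNIV)
    have "f (\<Sum>S) = (\<Sum>v\<in>S. f v)" by (rule linear_sum[OF lin])
    also have "\<dots> = \<Sum>(f ` S)"
      using inj by (simp add: sum.reindex inj_on_subset)
    finally show ?thesis using \<open>f ` S = S\<close> by simp
  qed
  then have "\<Sum>S = 0" using assms(3) by (auto simp: symmetric_polytope_def)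
  then have "(\<Sum>v\<in>S. b \<bullet> v) = 0" by (simp flip: inner_sum_right)
  moreover have "(\<Sum>v\<in>S. b \<bullet> v) > 0" if "S \<noteq> {}"
    using finS that by (intro sum_pos) (auto simp: S_def)
  ultimately have "S = {}" by force
  then have "{v. v extreme_point_of P} \<subseteq> {x. b \<bullet> x \<le> 0}" by (auto simp: S_def not_less)
  moreover have "P = convex hull {v. v extreme_point_of P}"
    using assms(1) by (intro Krein_Milman_Minkowski) (auto simp: polytope_imp_compact polytope_imp_convex)
  ultimately have "P \<subseteq> {x. b \<bullet> x \<le> 0}"
    by (metis convex_halfspace_le hull_minimal)
  moreover obtain e where e: "e > 0" "cball 0 e \<subseteq> P"
    using assms(2) by (meson mem_interior_cball)
  \<comment> \<open>If \<open>b \<noteq> 0\<close>, its positive multiple of length \<open>e\<close> lies in \<open>P\<close>, and \<open>b\<close> takes the value \<open>e * norm b\<close> on it.\<close>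
  moreover have "(e / norm b) *\<^sub>R b \<in> cball 0 e" using e by simp
  ultimately have "b \<bullet> ((e / norm b) *\<^sub>R b) \<le> 0" by blast
  then have "e * norm b \<le> 0" by (simp add: dot_square_norm power2_eq_square split: if_splits)
  then show ?thesis using e by (simp add: mult_le_0_iff)
qed

theorem theorem1p5:
  fixes P :: "(real ^ 'n) set"
  assumes "fano_polytope P"
    and "symmetric_polytope P"
  shows "kahler_einstein P"
proof -
  let ?b = "barycenter (dual_polytope P)"
  have P: "polytope P" "0 \<in> interior P"
    using assms(1) by (auto simp: fano_polytope_def)
  have "?b = 0"
  proof (rule symmetric_invariant_functional_zero[OF P assms(2)])
    fix f x assume "f \<in> Aut_polytope P"
    then have lin: "linear f" and fP: "f ` P = P"
      by (auto simp: Aut_polytope_def GL_lattice_def)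
    have "?b \<bullet> f x = adjoint f ?b \<bullet> x"
      using adjoint_works[OF lin, of x ?b] by (simp add: inner_commute)
    then show "?b \<bullet> f x = ?b \<bullet> x"
      using adjoint_fixes_barycenter_dual[OF lin fP polytope_imp_bounded[OF P(1)] P(2)] by simp
  qed
  then show ?thesis by (simp add: kahler_einstein_def)
qed

end
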